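(* Let $n=mk$, let $\mathcal{S}_q(m,k,P)\subseteq\mathcal{G}_q(k,n)$ be a Desarguesian spread code and let $0\le r<k$. Suppose the matrix representation $$U=(0\mid\cdots\mid0\mid I\mid B_{i+1}\mid\cdots\mid B_m)\in\mathcal{M}$$ of a codeword is transmitted over the column erasure channel and $r$ deletions (or row erasures) occurred. Let $\ell$ be the number of nonzero blocks $B_t$ (with $i+1\le t\le m$) and $$N_r:=\sum_{j=0}^{k-r-1}\binom{k}{j}(2^{k-r}-1)^j .$$ Then (at least) $$e_\ell:=N_r^m\Big(1-\Big(\frac{N_r-1}{N_r}\Big)^{\ell+1}\Big)$$ symbol erasure patterns $E\in\{0,?\}^{(k-r)\times n}$ can be uniquely decoded. As a consequence, the average number (over all codewords) of correctable symbol erasure patterns $E\in\{0,?\}^{(k-r)\times n}$ for $\mathcal{S}_q(m,k,P)$ is at least $$e_{\rm avg}^{(r)}:=\frac{N_r^m}{q^n-1}\Big(q^n-\Big[\frac{(q^k-1)(N_r-1)}{N_r}+1\Big]^m\Big).$$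
   Context: $q$ is a prime power and $\mathcal{G}_q(k,n)$ is the set of $k$-dimensional subspaces of $\mathbb{F}_q^n$; $\mathrm{rowsp}(U)$ is the row space of a matrix $U$. Let $p(x)=x^k+\sum_{i=0}^{k-1}p_ix^i\in\mathbb{F}_q[x]$ be monic irreducible and $P\in\mathrm{GL}_k(q)$ its companion matrix (ones on the subdiagonal, last column $(-p_0,\ldots,-p_{k-1})^\top$, zeros elsewhere). Then $\mathbb{F}_q[P]$ is a field of size $q^k$. Put $n=mk$ and $$\mathcal{M}=\{(0_{k\times k}\mid\cdots\mid 0_{k\times k}\mid I_k\mid B_{i+1}\mid\cdots\mid B_m)\;:\; 1\le i\le m,\ B_j\in\mathbb{F}_q[P]\},$$ where $I_k$ is the $i$-th block. The Desarguesian spread code is $\mathcal{S}_q(m,k,P)=\{\mathrm{rowsp}(G): G\in\mathcal{M}\}$; it has $(q^n-1)/(q^k-1)$ elements, one for each matrix in $\mathcal{M}$. The symbol $?$ denotes an erasure, with $y+?=?$ for all $y\in\mathbb{F}_q$. Column erasure channel with $r$ deletions: one may assume that the first $k-r$ rows of the received matrix form a basis of the received space, so only these are considered. If $U\in\mathcal{M}$ is sent, the receiver obtains $\gamma(AU+E)$, where $A\in\mathbb{F}_q^{(k-r)\times k}$ is an arbitrary matrix of rank $k-r$, unknown to the receiver, $E\in\{0,?\}^{(k-r)\times n}$ is the erasure pattern, and $\gamma$ replaces every column containing at least one $?$ by an all-$?$ column. $E$ can be uniquely decoded for $U$ if for all $U'\in\mathcal{M}$ and all $A,A'\in\mathbb{F}_q^{(k-r)\times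 k}$ of rank $k-r$, $\gamma(AU+E)=\gamma(A'U'+E)$ implies $\mathrm{rowsp}(U)=\mathrm{rowsp}(U')$. The average number of correctable patterns is the arithmetic mean, over all $U\in\mathcal{M}$, of the number of patterns $E$ (including $E=0$) that can be uniquely decoded for $U$. *)

theory Defs
  imports
    "Jordan_Normal_Form.DL_Rank"
    "HOL-Computational_Algebra.Polynomial"
    "HOL-Library.Cardinality"
begin

text \<open>
  Matrices are those of \<open>Jordan_Normal_Form\<close>, so rows, columns and hence blocks are numbered from 0.
  The finite field with \<open>q\<close> elements is a type \<open>'a\<close> of sort \<open>{field, finite}\<close> with \<open>q = CARD('a)\<close>.
\<close>

section \<open>Matrix representations of the Desarguesian spread code\<close>

definition companion_matrix :: "'a :: field poly \<Rightarrow> 'a mat" where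
  "companion_matrix p =
     mat (degree p) (degree p) (\<lambda>(a, b).
       if b = degree p - 1 then - coeff p a else if a = Suc b then 1 else 0)"

definition eval_at_mat :: "'a :: field mat \<Rightarrow> 'a poly \<Rightarrow> 'a mat" where
  "eval_at_mat P f =
     mat (dim_row P) (dim_row P) (\<lambda>(a, b). \<Sum>t\<le>degree f. coeff f t * (P ^\<^sub>m t) $$ (a, b))"

text \<open>The algebra \<open>F[P]\<close> generated by a square matrix \<open>P\<close>.\<close>

definition poly_algebra :: "'a :: field mat \<Rightarrow> 'a mat set" where
  "poly_algebra P = range (eval_at_mat P)"

text \<open>The matrix \<open>(B 0 | \<dots> | B (m - 1))\<close> composed of blocks of size \<open>k \<times> k\<close>.\<close>

definition block_row :: "nat \<Rightarrow> nat \<Rightarrow> (nat \<Rightarrow> 'a mat) \<Rightarrow> 'a mat" where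
  "block_row m k B = mat k (m * k) (\<lambda>(a, c). B (c div k) $$ (a, c mod k))"

definition normal_blocks :: "'a :: field mat \<Rightarrow> nat \<Rightarrow> nat \<Rightarrow> (nat \<Rightarrow> 'a mat) \<Rightarrow> bool" where
  "normal_blocks P m i B \<longleftrightarrow>
     i < m \<and>
     (\<forall>j<i. B j = 0\<^sub>m (dim_row P) (dim_row P)) \<and>
     B i = 1\<^sub>m (dim_row P) \<and>
     (\<forall>j. i < j \<and> j < m \<longrightarrow> B j \<in> poly_algebra P)"

text \<open>
  The set \<open>\<M>\<close> of matrix representations; the codewords of the Desarguesian spread code are
  the row spaces of its members.
\<close>

definition spread_matrices :: "nat \<Rightarrow> nat \<Rightarrow> 'a :: field mat \<Rightarrow> 'a mat set" where
  "spread_matrices m k P = {block_row m k B | i B. normal_blocks P m i B}"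

abbreviation rowsp :: "'a :: field mat \<Rightarrow> 'a vec set" where
  "rowsp U \<equiv> vec_space.row_space (dim_col U) U"

section \<open>The column erasure channel\<close>

text \<open>A received symbol is \<open>Some y\<close> for a field element \<open>y\<close>, or \<open>None\<close> for an erasure.\<close>

fun symbol_add :: "'a :: plus option \<Rightarrow> 'a option \<Rightarrow> 'a option" where
  "symbol_add (Some x) (Some y) = Some (x + y)"
| "symbol_add _ _ = None"

definition symbol_mat_add :: "'a :: plus option mat \<Rightarrow> 'a option mat \<Rightarrow> 'a option mat" where
  "symbol_mat_add X Y =
     mat (dim_row X) (dim_col X) (\<lambda>(a, c). symbol_add (X $$ (a, c)) (Y $$ (a, c)))"

definition erase_columns :: "'a option mat \<Rightarrow> 'a option mat" where
  "erase_columns Y =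
     mat (dim_row Y) (dim_col Y) (\<lambda>(a, c).
       if \<exists>b<dim_row Y. Y $$ (b, c) = None then None else Y $$ (a, c))"

definition erasure_patterns :: "nat \<Rightarrow> nat \<Rightarrow> 'a :: zero option mat set" where
  "erasure_patterns s n = {E \<in> carrier_mat s n. elements_mat E \<subseteq> {Some 0, None}}"

definition received :: "'a :: field mat \<Rightarrow> 'a mat \<Rightarrow> 'a option mat \<Rightarrow> 'a option mat" where
  "received A U E = erase_columns (symbol_mat_add (map_mat Some (A * U)) E)"

text \<open>
  The matrices \<open>A\<close> by which the channel can multiply a matrix with \<open>k\<close> rows when \<open>s = k - r\<close> rows survive.
\<close>

definition deletion_matrices :: "nat \<Rightarrow> nat \<Rightarrow> 'a :: field mat set" where
  "deletion_matrices s k = {A \<in> carrier_mat s k. vec_space.rank s A = s}"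

definition uniquely_decodable ::
  "nat \<Rightarrow> nat \<Rightarrow> 'a :: field mat \<Rightarrow> nat \<Rightarrow> 'a mat \<Rightarrow> 'a option mat \<Rightarrow> bool" where
  "uniquely_decodable m k P r U E \<longleftrightarrow>
     (\<forall>U' \<in> spread_matrices m k P.
      \<forall>A \<in> deletion_matrices (k - r) k. \<forall>A' \<in> deletion_matrices (k - r) k.
        received A U E = received A' U' E \<longrightarrow> rowsp U = rowsp U')"

definition correctable_patterns ::
  "nat \<Rightarrow> nat \<Rightarrow> 'a :: field mat \<Rightarrow> nat \<Rightarrow> 'a mat \<Rightarrow> 'a option mat set" where
  "correctable_patterns m k P r U =
     {E \<in> erasure_patterns (k - r) (m * k). uniquely_decodable m k P r U E}"

definition average_correctable :: "nat \<Rightarrow> nat \<Rightarrow> 'a :: field mat \<Rightarrow> nat \<Rightarrow> real" where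
  "average_correctable m k P r =
     (\<Sum>U\<in>spread_matrices m k P. real (card (correctable_patterns m k P r U)))
       / real (card (spread_matrices m k P))"

text \<open>The number \<open>N\<^sub>r\<close>, meant for \<open>r < k\<close>.\<close>

definition N_patterns :: "nat \<Rightarrow> nat \<Rightarrow> real" where
  "N_patterns k r = (\<Sum>j = 0..k - r - 1. real (k choose j) * (2 ^ (k - r) - 1) ^ j)"

end

theory Submission
  imports Defs
begin

text \<open>
  Call a pattern light if it erases fewer than \<open>s = k - r\<close> columns in each block; a block has \<open>N\<^sub>r\<close> light
  patterns. If a light pattern leaves some nonzero block \<open>B t\<close> of \<open>U\<close> free of erasures, comparing that
  block gives \<open>A' = A * D\<close> for an element \<open>D\<close> of the field \<open>F[P]\<close>. A nonzero element of this field is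
  invertible, so multiplying it by the rank \<open>s\<close> matrix \<open>A\<close> leaves at least \<open>s\<close> nonzero columns, which
  light erasures cannot hide. Hence \<open>U = D * U'\<close>, and the normal form forces \<open>U = U'\<close>. The bound \<open>e\<^sub>l\<close>
  counts the light patterns that vanish on one of the \<open>l + 1\<close> nonzero blocks, and averaging is
  a sum of geometric series over the position of the pivot block.
\<close>

section \<open>Entrywise facts about matrices\<close>

lemma mult_mat_index:
  assumes "A \<in> carrier_mat n k" "B \<in> carrier_mat k m" "a < n" "b < m"
  shows "(A * B) $$ (a, b) = (\<Sum>x<k. A $$ (a, x) * B $$ (x, b))"
  using assms by (auto simp: scalar_prod_def atLeast0LessThan intro!: sum.cong)

lemma minus_mat_eq_0_imp_eq:
  fixes A B :: "'a :: group_add mat"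
  assumes "A \<in> carrier_mat n m" "B \<in> carrier_mat n m" "A - B = 0\<^sub>m n m"
  shows "A = B"
proof (rule eq_matI)
  fix a b assume "a < dim_row B" "b < dim_col B"
  moreover from this have "(A - B) $$ (a, b) = 0"
    using assms(2) by (simp add: assms(3))
  ultimately have "A $$ (a, b) - B $$ (a, b) = 0"
    using assms(1,2) by simp
  then show "A $$ (a, b) = B $$ (a, b)" by simp
qed (use assms in auto)

section \<open>Evaluating polynomials at a matrix\<close>

lemma eval_at_mat_dim [simp]:
  "dim_row (eval_at_mat P f) = dim_row P" "dim_col (eval_at_mat P f) = dim_row P"
  by (simp_all add: eval_at_mat_def)

lemma eval_at_mat_carrier:
  assumes "P \<in> carrier_mat k k"
  shows "eval_at_mat P f \<in> carrier_mat k k"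
  using assms by auto

text \<open>The terms beyond the degree vanish. The free bound \<open>N\<close> allows evaluations
  of polynomials of different degrees to be written with one common range of summation.\<close>

lemma eval_at_mat_index:
  assumes "P \<in> carrier_mat k k" "a < k" "b < k" "degree f \<le> N"
  shows "eval_at_mat P f $$ (a, b) = (\<Sum>t\<le>N. coeff f t * (P ^\<^sub>m t) $$ (a, b))"
proof -
  have "eval_at_mat P f $$ (a, b) = (\<Sum>t\<le>degree f. coeff f t * (P ^\<^sub>m t) $$ (a, b))"
    using assms by (auto simp: eval_at_mat_def)
  also have "\<dots> = (\<Sum>t\<le>N. coeff f t * (P ^\<^sub>m t) $$ (a, b))"
    by (rule sum.mono_neutral_left) (use assms(4) in \<open>auto simp: coeff_eq_0\<close>)
  finally show ?thesis .
qed

lemma eval_at_mat_0: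
  assumes "P \<in> carrier_mat k k"
  shows "eval_at_mat P 0 = 0\<^sub>m k k"
  by (rule eq_matI) (use assms in \<open>auto simp: eval_at_mat_def\<close>)

lemma eval_at_mat_monom:
  assumes "P \<in> carrier_mat k k"
  shows "eval_at_mat P (monom 1 n) = P ^\<^sub>m n"
proof (rule eq_matI)
  fix a b assume "a < dim_row (P ^\<^sub>m n)" "b < dim_col (P ^\<^sub>m n)"
  then have ab: "a < k" "b < k" using pow_mat_dim_square[OF assms, of n] by auto
  have "eval_at_mat P (monom 1 n) $$ (a, b) = (\<Sum>t\<le>n. if t = n then (P ^\<^sub>m n) $$ (a, b) else 0)"
    unfolding eval_at_mat_index[OF assms ab degree_monom_le] by (intro sum.cong) auto
  then show "eval_at_mat P (monom 1 n) $$ (a, b) = (P ^\<^sub>m n) $$ (a, b)" by simp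
qed (use assms in \<open>auto simp: eval_at_mat_def\<close>)

lemma eval_at_mat_add:
  assumes "P \<in> carrier_mat k k"
  shows "eval_at_mat P (f + g) = eval_at_mat P f + eval_at_mat P g"
proof (rule eq_matI)
  fix a b assume "a < dim_row (eval_at_mat P f + eval_at_mat P g)"
    "b < dim_col (eval_at_mat P f + eval_at_mat P g)"
  then have ab: "a < k" "b < k" using assms by (auto simp: eval_at_mat_def)
  let ?N = "max (degree f) (degree g)"
  have "degree (f + g) \<le> ?N" by (rule degree_add_le_max)
  then show "eval_at_mat P (f + g) $$ (a, b) = (eval_at_mat P f + eval_at_mat P g) $$ (a, b)"
    using ab assms eval_at_mat_index[OF assms ab, of f ?N] eval_at_mat_index[OF assms ab, of g ?N]
      eval_at_mat_index[OF assms ab, of "f + g" ?N]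
    by (auto simp: sum.distrib distrib_right eval_at_mat_def)
qed (use assms in \<open>auto simp: eval_at_mat_def\<close>)

lemma eval_at_mat_smult:
  assumes "P \<in> carrier_mat k k"
  shows "eval_at_mat P (Polynomial.smult c f) = c \<cdot>\<^sub>m eval_at_mat P f"
proof (rule eq_matI)
  fix a b assume "a < dim_row (c \<cdot>\<^sub>m eval_at_mat P f)" "b < dim_col (c \<cdot>\<^sub>m eval_at_mat P f)"
  then have ab: "a < k" "b < k" using assms by (auto simp: eval_at_mat_def)
  show "eval_at_mat P (Polynomial.smult c f) $$ (a, b) = (c \<cdot>\<^sub>m eval_at_mat P f) $$ (a, b)"
    using ab assms eval_at_mat_index[OF assms ab, of f "degree f"]
      eval_at_mat_index[OF assms ab degree_smult_le, of c f]
    by (auto simp: sum_distrib_left mult.assoc eval_at_mat_def)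
qed (use assms in \<open>auto simp: eval_at_mat_def\<close>)

lemma eval_at_mat_shift:
  assumes "P \<in> carrier_mat k k"
  shows "eval_at_mat P (pCons 0 f) = eval_at_mat P f * P"
proof (rule eq_matI)
  fix a b assume "a < dim_row (eval_at_mat P f * P)" "b < dim_col (eval_at_mat P f * P)"
  then have ab: "a < k" "b < k" using assms by (auto simp: eval_at_mat_def)
  have "(eval_at_mat P f * P) $$ (a, b) = (\<Sum>x<k. eval_at_mat P f $$ (a, x) * P $$ (x, b))"
    by (rule mult_mat_index[OF eval_at_mat_carrier[OF assms] assms ab])
  also have "\<dots> = (\<Sum>x<k. \<Sum>t\<le>degree f. coeff f t * ((P ^\<^sub>m t) $$ (a, x) * P $$ (x, b)))"
    by (simp add: eval_at_mat_index[OF assms ab(1) _ order.refl] sum_distrib_right mult.assoc)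
  also have "\<dots> = (\<Sum>t\<le>degree f. coeff f t * (\<Sum>x<k. (P ^\<^sub>m t) $$ (a, x) * P $$ (x, b)))"
    by (subst sum.swap) (simp add: sum_distrib_left)
  also have "\<dots> = (\<Sum>t\<le>degree f. coeff f t * (P ^\<^sub>m Suc t) $$ (a, b))"
    by (simp add: mult_mat_index[OF pow_carrier_mat[OF assms] assms ab])
  also have "\<dots> = (\<Sum>t\<le>Suc (degree f). coeff (pCons 0 f) t * (P ^\<^sub>m t) $$ (a, b))"
    unfolding sum.atMost_Suc_shift by simp
  also have "\<dots> = eval_at_mat P (pCons 0 f) $$ (a, b)"
    by (rule eval_at_mat_index[OF assms ab, symmetric]) (simp add: degree_pCons_le)
  finally show "eval_at_mat P (pCons 0 f) $$ (a, b) = (eval_at_mat P f * P) $$ (a, b)" ..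
qed (use assms in \<open>auto simp: eval_at_mat_def\<close>)

lemma eval_at_mat_pCons:
  assumes "P \<in> carrier_mat k k"
  shows "eval_at_mat P (pCons c f) = c \<cdot>\<^sub>m 1\<^sub>m k + eval_at_mat P f * P"
proof -
  have "pCons c f = Polynomial.smult c (monom 1 0) + pCons 0 f" by (simp add: monom_0)
  then show ?thesis
    using assms by (simp only: eval_at_mat_add eval_at_mat_smult eval_at_mat_shift eval_at_mat_monom) simp
qed

lemma eval_at_mat_1:
  assumes "P \<in> carrier_mat k k"
  shows "eval_at_mat P 1 = 1\<^sub>m k"
  using eval_at_mat_monom[OF assms, of 0] assms by (simp add: monom_0 one_pCons)

text \<open>Matrix powers grow by a factor \<open>P\<close> on the right. Commutation moves that
  factor to the left, where it acts on columns, and it drives the induction for products of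
  polynomials.\<close>

lemma eval_at_mat_commutes_base:
  assumes P: "P \<in> carrier_mat k k"
  shows "P * eval_at_mat P f = eval_at_mat P f * P"
proof (induction f)
  case 0
  then show ?case using P by (simp add: eval_at_mat_0)
next
  case (pCons c f)
  note E = eval_at_mat_carrier[OF P, of f]
  have "P * (c \<cdot>\<^sub>m 1\<^sub>m k + eval_at_mat P f * P) = c \<cdot>\<^sub>m P + P * eval_at_mat P f * P"
    using P by (simp add: mult_add_distrib_mat[OF P _ mult_carrier_mat[OF E P]]
        mult_smult_distrib[OF P one_carrier_mat] assoc_mult_mat[OF P E P])
  also have "\<dots> = (c \<cdot>\<^sub>m 1\<^sub>m k + eval_at_mat P f * P) * P"
    unfolding pCons.IH
    using P by (simp add: add_mult_distrib_mat[OF _ mult_carrier_mat[OF E P] P]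
        mult_smult_assoc_mat[OF one_carrier_mat P])
  finally show ?case unfolding eval_at_mat_pCons[OF P] .
qed

lemma eval_at_mat_mult:
  assumes P: "P \<in> carrier_mat k k"
  shows "eval_at_mat P (f * g) = eval_at_mat P f * eval_at_mat P g"
proof (induction f)
  case 0
  show ?case by (simp add: eval_at_mat_0[OF P] left_mult_zero_mat[OF eval_at_mat_carrier[OF P]])
next
  case (pCons c f)
  note E = eval_at_mat_carrier[OF P]
  note F = E[of f] and G = E[of g]
  have "eval_at_mat P (pCons c f * g) = c \<cdot>\<^sub>m eval_at_mat P g + eval_at_mat P f * eval_at_mat P g * P"
    by (simp add: eval_at_mat_add[OF P] eval_at_mat_smult[OF P] eval_at_mat_shift[OF P] pCons.IH)
  also have "eval_at_mat P f * eval_at_mat P g * P = eval_at_mat P f * P * eval_at_mat P g"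
    by (simp add: assoc_mult_mat[OF F P G] assoc_mult_mat[OF F G P] eval_at_mat_commutes_base[OF P])
  also have "c \<cdot>\<^sub>m eval_at_mat P g + \<dots> = eval_at_mat P (pCons c f) * eval_at_mat P g"
    unfolding eval_at_mat_pCons[OF P]
    using G by (simp add: add_mult_distrib_mat[OF _ mult_carrier_mat[OF F P] G]
        mult_smult_assoc_mat[OF one_carrier_mat G] left_mult_one_mat[OF G])
  finally show ?case .
qed

lemma poly_algebra_carrier:
  assumes "P \<in> carrier_mat k k" "B \<in> poly_algebra P"
  shows "B \<in> carrier_mat k k"
  using assms by (auto simp: poly_algebra_def intro: eval_at_mat_carrier)

lemma poly_algebra_0: "P \<in> carrier_mat k k \<Longrightarrow> 0\<^sub>m k k \<in> poly_algebra P"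
  unfolding poly_algebra_def by (metis eval_at_mat_0 rangeI)

lemma poly_algebra_1: "P \<in> carrier_mat k k \<Longrightarrow> 1\<^sub>m k \<in> poly_algebra P"
  unfolding poly_algebra_def by (metis eval_at_mat_1 rangeI)

lemma poly_algebra_mult:
  assumes "P \<in> carrier_mat k k" "B \<in> poly_algebra P" "C \<in> poly_algebra P"
  shows "B * C \<in> poly_algebra P"
  using assms(2,3) by (auto simp: poly_algebra_def simp flip: eval_at_mat_mult[OF assms(1)])

lemma poly_algebra_diff:
  assumes P: "P \<in> carrier_mat k k" and "B \<in> poly_algebra P" "C \<in> poly_algebra P"
  shows "B - C \<in> poly_algebra P"
proof -
  obtain f g where fg: "B = eval_at_mat P f" "C = eval_at_mat P g"
    using assms by (auto simp: poly_algebra_def)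
  have "B - C = eval_at_mat P (f + Polynomial.smult (-1) g)"
    unfolding eval_at_mat_add[OF P] eval_at_mat_smult[OF P] fg
    by (rule eq_matI) (use P in \<open>auto simp: eval_at_mat_def\<close>)
  then show ?thesis by (simp add: poly_algebra_def)
qed

section \<open>The field generated by a companion matrix\<close>

locale irreducible_companion =
  fixes p :: "'a :: {field, finite} poly" and P :: "'a mat" and k :: nat
  assumes monic: "lead_coeff p = 1" and irreducible: "irreducible p" and degree: "degree p = k"
    and P_def: "P = companion_matrix p"
begin

lemma k_pos: "0 < k"
  using irreducible degree by (metis gr0I is_unit_iff_degree irreducible_def)

lemma P_carrier [simp]: "P \<in> carrier_mat k k"
  by (simp add: P_def companion_matrix_def degree)

lemma P_dim [simp]: "dim_row P = k" "dim_col P = k"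
  using P_carrier by blast+

lemmas K_carrier = poly_algebra_carrier[OF P_carrier]
lemmas K_0 = poly_algebra_0[OF P_carrier]
lemmas K_1 = poly_algebra_1[OF P_carrier]
lemmas K_mult = poly_algebra_mult[OF P_carrier]
lemmas K_diff = poly_algebra_diff[OF P_carrier]

text \<open>Write e_t for the unit vectors, t counted from 0. The subdiagonal of ones makes
  \<open>P\<close> send e_t to e_(t+1) as long as t + 1 < k, so \<open>P ^\<^sub>m t\<close> sends
  e_0 to e_t.\<close>

lemma power_first_column:
  assumes "t < k" "a < k"
  shows "(P ^\<^sub>m t) $$ (a, 0) = (if a = t then 1 else 0)"
  using assms
proof (induction t arbitrary: a)
  case 0
  then show ?case by simp
next
  case (Suc t)
  have "P ^\<^sub>m Suc t = P * P ^\<^sub>m t"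
    using eval_at_mat_commutes_base[OF P_carrier, of "monom 1 t"] by (simp add: eval_at_mat_monom[OF P_carrier])
  then have "(P ^\<^sub>m Suc t) $$ (a, 0) = (\<Sum>x<k. P $$ (a, x) * (P ^\<^sub>m t) $$ (x, 0))"
    using Suc.prems k_pos by (auto simp: scalar_prod_def atLeast0LessThan intro!: sum.cong)
  also have "\<dots> = (\<Sum>x<k. if x = t then P $$ (a, t) else 0)"
    using Suc by (intro sum.cong) auto
  also have "\<dots> = P $$ (a, t)" using Suc.prems by simp
  also have "\<dots> = (if a = Suc t then 1 else 0)"
    using Suc.prems by (auto simp: P_def companion_matrix_def degree)
  finally show ?case .
qed

text \<open>One step further, \<open>P\<close> is applied to e_(k-1), which reads off its last
  column.\<close>

lemma power_k_first_column:
  assumes "a < k"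
  shows "(P ^\<^sub>m k) $$ (a, 0) = - coeff p a"
proof -
  obtain t where t: "k = Suc t" using k_pos gr0_conv_Suc by auto
  have "P ^\<^sub>m Suc t = P * P ^\<^sub>m t"
    using eval_at_mat_commutes_base[OF P_carrier, of "monom 1 t"] by (simp add: eval_at_mat_monom[OF P_carrier])
  then have "(P ^\<^sub>m k) $$ (a, 0) = (\<Sum>x<k. P $$ (a, x) * (P ^\<^sub>m t) $$ (x, 0))"
    using assms k_pos by (auto simp: t scalar_prod_def atLeast0LessThan intro!: sum.cong)
  also have "\<dots> = (\<Sum>x<k. if x = t then P $$ (a, t) else 0)"
    by (intro sum.cong) (auto simp: power_first_column t)
  also have "\<dots> = P $$ (a, t)" by (simp add: t)
  also have "\<dots> = - coeff p a"
    using assms t degree by (auto simp: P_def companion_matrix_def)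
  finally show ?thesis .
qed

lemma eval_first_column:
  assumes "degree f < k" "a < k"
  shows "eval_at_mat P f $$ (a, 0) = coeff f a"
proof -
  have "eval_at_mat P f $$ (a, 0) = (\<Sum>t\<le>k - 1. coeff f t * (P ^\<^sub>m t) $$ (a, 0))"
    using assms by (intro eval_at_mat_index[OF P_carrier]) auto
  also have "\<dots> = (\<Sum>t\<le>k - 1. if t = a then coeff f a else 0)"
    using assms by (intro sum.cong) (auto simp: power_first_column)
  also have "\<dots> = coeff f a" using assms by simp
  finally show ?thesis .
qed

text \<open>The vector e_0 is cyclic: e_b is the image of e_0 under \<open>P ^\<^sub>m b\<close>. As
  \<open>B\<close> commutes with powers of \<open>P\<close>, column \<open>b\<close> of
  \<open>B\<close> is \<open>P ^\<^sub>m b\<close> applied to the first column of \<open>B\<close>,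
  which is zero.\<close>

lemma K_zero_if_first_column:
  assumes B: "B \<in> poly_algebra P" and zero: "\<And>a. a < k \<Longrightarrow> B $$ (a, 0) = 0"
  shows "B = 0\<^sub>m k k"
proof (rule eq_matI)
  obtain f where f: "B = eval_at_mat P f" using B by (auto simp: poly_algebra_def)
  fix a b assume "a < dim_row (0\<^sub>m k k)" "b < dim_col (0\<^sub>m k k)"
  then have ab: "a < k" "b < k" by auto
  note Bc = K_carrier[OF B]
  have comm: "B * P ^\<^sub>m b = P ^\<^sub>m b * B"
    using eval_at_mat_mult[OF P_carrier, of f "monom 1 b"] eval_at_mat_mult[OF P_carrier, of "monom 1 b" f]
    by (simp add: f eval_at_mat_monom[OF P_carrier] mult.commute)
  have "B $$ (a, b) = (\<Sum>x<k. B $$ (a, x) * (P ^\<^sub>m b) $$ (x, 0))"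
  proof -
    have "(\<Sum>x<k. B $$ (a, x) * (P ^\<^sub>m b) $$ (x, 0)) = (\<Sum>x<k. if x = b then B $$ (a, b) else 0)"
      using ab by (intro sum.cong) (auto simp: power_first_column)
    then show ?thesis using ab by simp
  qed
  also have "\<dots> = (B * P ^\<^sub>m b) $$ (a, 0)"
    using ab Bc k_pos by (auto simp: scalar_prod_def atLeast0LessThan intro!: sum.cong)
  also have "\<dots> = (\<Sum>x<k. (P ^\<^sub>m b) $$ (a, x) * B $$ (x, 0))"
    unfolding comm using ab Bc k_pos by (auto simp: scalar_prod_def atLeast0LessThan intro!: sum.cong)
  also have "\<dots> = 0" using zero by simp
  finally show "B $$ (a, b) = 0\<^sub>m k k $$ (a, b)" using ab by simp
qed (use K_carrier[OF B] in auto)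

text \<open>Cayley-Hamilton for the companion matrix. By cyclicity only the first column has to be
  checked; there the lower coefficients of \<open>p\<close> cancel against the last column of
  \<open>P\<close>.\<close>

lemma eval_p: "eval_at_mat P p = 0\<^sub>m k k"
proof (rule K_zero_if_first_column)
  fix a assume a: "a < k"
  have "eval_at_mat P p $$ (a, 0) = (\<Sum>t\<le>k. coeff p t * (P ^\<^sub>m t) $$ (a, 0))"
    using a degree by (intro eval_at_mat_index[OF P_carrier]) auto
  also have "\<dots> = (\<Sum>t<k. coeff p t * (P ^\<^sub>m t) $$ (a, 0)) + coeff p k * (P ^\<^sub>m k) $$ (a, 0)"
    by (simp add: ivl_disj_un_singleton(2)[symmetric] add.commute)
  also have "(\<Sum>t<k. coeff p t * (P ^\<^sub>m t) $$ (a, 0)) = (\<Sum>t<k. if t = a then coeff p a else 0)"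
    using a by (intro sum.cong) (auto simp: power_first_column)
  also have "\<dots> + coeff p k * (P ^\<^sub>m k) $$ (a, 0) = 0"
    using a monic degree power_k_first_column[OF a] by simp
  finally show "eval_at_mat P p $$ (a, 0) = 0" .
qed (simp add: poly_algebra_def)

lemma eval_mod: "eval_at_mat P (f mod p) = eval_at_mat P f"
proof -
  have "eval_at_mat P f = eval_at_mat P (f div p * p + f mod p)" by simp
  also have "\<dots> = eval_at_mat P (f div p) * 0\<^sub>m k k + eval_at_mat P (f mod p)"
    by (simp only: eval_at_mat_add[OF P_carrier] eval_at_mat_mult[OF P_carrier] eval_p)
  also have "\<dots> = eval_at_mat P (f mod p)"
    using eval_at_mat_carrier[OF P_carrier, of "f div p"] eval_at_mat_carrier[OF P_carrier, of "f mod p"]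
    by (simp add: right_mult_zero_mat[of _ k k])
  finally show ?thesis ..
qed

lemma degree_mod: "degree (f mod p) < k"
  using degree_mod_less[of p f] k_pos degree by fastforce

text \<open>Evaluation depends only on the remainder modulo \<open>p\<close>, and the first column
  displays the coefficients of that remainder. So \<open>p\<close> generates the kernel of the
  evaluation map.\<close>

lemma eval_eq_0_iff: "eval_at_mat P f = 0\<^sub>m k k \<longleftrightarrow> p dvd f"
proof
  assume "eval_at_mat P f = 0\<^sub>m k k"
  then have "eval_at_mat P (f mod p) = 0\<^sub>m k k" by (simp add: eval_mod)
  then have "coeff (f mod p) a = 0" if "a < k" for a
    using eval_first_column[OF degree_mod[of f] that] that k_pos by simp
  moreover have "coeff (f mod p) a = 0" if "\<not> a < k" for a
    using degree_mod[of f] that by (intro coeff_eq_0) simp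
  ultimately have "f mod p = 0" by (metis leading_coeff_0_iff)
  then show "p dvd f" by (simp add: dvd_eq_mod_eq_0)
next
  assume "p dvd f"
  then have "eval_at_mat P (f mod p) = 0\<^sub>m k k" by (simp add: eval_at_mat_0[OF P_carrier])
  then show "eval_at_mat P f = 0\<^sub>m k k" by (simp add: eval_mod)
qed

text \<open>First columns serve as coordinates on the algebra. Injectivity is cyclicity of e_0
  applied to a difference; for surjectivity, the polynomial with the prescribed coefficients is
  evaluated. This yields the size \<open>CARD('a) ^ k\<close>.\<close>

lemma K_bij:
  "bij_betw (\<lambda>B. \<lambda>a\<in>{..<k}. B $$ (a, 0)) (poly_algebra P) ({..<k} \<rightarrow>\<^sub>E UNIV)"
proof (rule bij_betw_imageI)
  show "inj_on (\<lambda>B. \<lambda>a\<in>{..<k}. B $$ (a, 0)) (poly_algebra P)"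
  proof (rule inj_onI)
    fix B C assume BC: "B \<in> poly_algebra P" "C \<in> poly_algebra P"
      and eq: "(\<lambda>a\<in>{..<k}. B $$ (a, 0)) = (\<lambda>a\<in>{..<k}. C $$ (a, 0))"
    have "B $$ (a, 0) = C $$ (a, 0)" if "a < k" for a
      using fun_cong[OF eq, of a] that by simp
    then have "B - C = 0\<^sub>m k k"
      using K_carrier[OF BC(1)] K_carrier[OF BC(2)] k_pos
      by (intro K_zero_if_first_column K_diff BC) auto
    then show "B = C" by (rule minus_mat_eq_0_imp_eq[OF K_carrier K_carrier, OF BC])
  qed
  show "(\<lambda>B. \<lambda>a\<in>{..<k}. B $$ (a, 0)) ` poly_algebra P = {..<k} \<rightarrow>\<^sub>E UNIV"
  proof (intro equalityI subsetI)
    fix c :: "nat \<Rightarrow> 'a" assume c: "c \<in> {..<k} \<rightarrow>\<^sub>E UNIV"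
    define f where "f = Poly (map c [0..<k])"
    have "coeff f a = (if a < k then c a else 0)" for a
      by (simp add: f_def nth_default_def)
    \<comment> \<open>A degree of at least \<open>k\<close> would make the leading coefficient zero,
      hence \<open>f = 0\<close>, whose degree is 0 and below \<open>k\<close>.\<close>
    moreover from this have "degree f < k"
      using k_pos by (metis degree_0 leading_coeff_0_iff)
    ultimately have "(\<lambda>a\<in>{..<k}. eval_at_mat P f $$ (a, 0)) = c"
      using c by (auto simp: fun_eq_iff eval_first_column PiE_def extensional_def)
    then show "c \<in> (\<lambda>B. \<lambda>a\<in>{..<k}. B $$ (a, 0)) ` poly_algebra P"
      unfolding poly_algebra_def by blast
  qed (auto simp: PiE_def)
qed

lemma K_finite: "finite (poly_algebra P)"
  using bij_betw_finite[OF K_bij] by (simp add: finite_PiE)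

lemma K_card: "card (poly_algebra P) = CARD('a) ^ k"
  using bij_betw_same_card[OF K_bij] by (simp add: card_PiE)

lemma K_inverse:
  assumes B: "B \<in> poly_algebra P" and nz: "B \<noteq> 0\<^sub>m k k"
  obtains C where "C \<in> poly_algebra P" "B * C = 1\<^sub>m k" "C * B = 1\<^sub>m k"
proof -
  obtain f where f: "B = eval_at_mat P f" using B by (auto simp: poly_algebra_def)
  have prime: "prime_elem p" using irreducible by (rule field_poly_irreducible_imp_prime)
  have "\<not> p dvd f" using nz by (simp add: f eval_eq_0_iff)
  \<comment> \<open>Multiplication by \<open>B\<close> is injective because \<open>p\<close> is prime, hence bijective on the finite algebra.\<close>
  have "inj_on (\<lambda>C. B * C) (poly_algebra P)"
  proof (rule inj_onI)
    fix C D assume CD: "C \<in> poly_algebra P" "D \<in> poly_algebra P" and eq: "B * C = B * D"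
    obtain g where g: "C - D = eval_at_mat P g" using K_diff[OF CD] by (auto simp: poly_algebra_def)
    have "eval_at_mat P (f * g) = B * C - B * D"
      using K_carrier[OF B] K_carrier[OF CD(1)] K_carrier[OF CD(2)]
      by (simp add: eval_at_mat_mult[OF P_carrier] flip: f g) (rule mult_minus_distrib_mat)
    also have "\<dots> = 0\<^sub>m k k"
      using eq K_carrier[OF B] K_carrier[OF CD(2)] by simp
    finally have "p dvd f * g" by (simp add: eval_eq_0_iff)
    then have "p dvd g" using prime \<open>\<not> p dvd f\<close> by (auto dest: prime_elem_dvd_multD)
    then have "C - D = 0\<^sub>m k k" using g by (simp add: eval_eq_0_iff)
    then show "C = D" by (rule minus_mat_eq_0_imp_eq[OF K_carrier K_carrier, OF CD])
  qed
  moreover have "(\<lambda>C. B * C) ` poly_algebra P \<subseteq> poly_algebra P"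
    using B K_mult by blast
  ultimately have "(\<lambda>C. B * C) ` poly_algebra P = poly_algebra P"
    by (intro endo_inj_surj K_finite)
  then obtain C where C: "C \<in> poly_algebra P" "B * C = 1\<^sub>m k"
    using K_1 by (metis (no_types, lifting) image_iff)
  moreover have "C * B = B * C"
    using B C(1) unfolding poly_algebra_def by (auto simp: mult.commute simp flip: eval_at_mat_mult[OF P_carrier])
  ultimately show ?thesis using that by simp
qed

lemma card_field_ge_2: "2 \<le> CARD('a)"
proof -
  have "card {0, 1 :: 'a} \<le> CARD('a)" by (rule card_mono) auto
  then show ?thesis by simp
qed

end

section \<open>Full rank after column erasures\<close>

lemma (in vec_space) mult_mat_vec_in_span:
  assumes M: "M \<in> carrier_mat n nc" and v: "v \<in> carrier_vec nc" and W: "W \<subseteq> carrier_vec n"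
    and cols: "\<And>j. j < nc \<Longrightarrow> col M j \<in> span W"
  shows "M *\<^sub>v v \<in> span W"
proof -
  let ?xs = "map (\<lambda>j. v $ j \<cdot>\<^sub>v col M j) [0..<nc]"
  have xs: "x \<in> carrier_vec n" if "x \<in> set ?xs" for x using M that by auto
  then have dim: "dim_vec (sumlist ?xs) = n" by (rule sumlist_dim)
  have "M *\<^sub>v v = sumlist ?xs"
  proof (rule eq_vecI)
    show "dim_vec (M *\<^sub>v v) = dim_vec (sumlist ?xs)"
      using M unfolding dim by simp
    fix i assume "i < dim_vec (sumlist ?xs)"
    then have i: "i < n" unfolding dim .
    have "sumlist ?xs $ i = (\<Sum>j = 0..<nc. (?xs ! j) $ i)"
      using sumlist_nth[of ?xs i] xs i by fastforce
    also have "\<dots> = (\<Sum>j = 0..<nc. M $$ (i, j) * v $ j)"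
      using M i by (intro sum.cong) auto
    also have "\<dots> = (M *\<^sub>v v) $ i"
      using M v i by (auto simp: scalar_prod_def intro!: sum.cong)
    finally show "(M *\<^sub>v v) $ i = sumlist ?xs $ i" ..
  qed
  moreover have "sumlist ?xs \<in> span W"
    by (rule sumlist_in_span[OF W]) (use M W cols in auto)
  ultimately show ?thesis by simp
qed

text \<open>Since \<open>A = (A * C) * D\<close>, the nonzero columns of \<open>A * C\<close> span the column space of \<open>A\<close>.\<close>

lemma (in vec_space) rank_le_nonzero_cols:
  assumes A: "A \<in> carrier_mat n k" and C: "C \<in> carrier_mat k k" and D: "D \<in> carrier_mat k k"
    and CD: "C * D = 1\<^sub>m k"
  shows "rank A \<le> card {c. c < k \<and> col (A * C) c \<noteq> 0\<^sub>v n}"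
proof -
  let ?I = "{c. c < k \<and> col (A * C) c \<noteq> 0\<^sub>v n}"
  define W where "W = col (A * C) ` ?I"
  have AC: "A * C \<in> carrier_mat n k" using A C by simp
  have W: "W \<subseteq> carrier_vec n" "finite W" using AC by (auto simp: W_def)
  have "col (A * C) c \<in> span W" if "c < k" for c
  proof (cases "col (A * C) c = 0\<^sub>v n")
    case True
    then show ?thesis using prod_in_span[of "0\<^sub>v n" W 0] W(1) by simp
  next
    case False
    then have "col (A * C) c \<in> W" using that by (auto simp: W_def)
    then show ?thesis using in_own_span W by auto
  qed
  then have "(A * C) *\<^sub>v col D c \<in> span W" if "c < k" for c
    using D that by (intro mult_mat_vec_in_span[OF AC _ W(1)]) auto
  moreover have "col A c = (A * C) *\<^sub>v col D c" if "c < k" for c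
  proof -
    have "A = (A * C) * D" using A C D CD by simp
    then show ?thesis using col_mult2[OF AC D that] by simp
  qed
  ultimately have span: "set (cols A) \<subseteq> span W"
    using A by (auto simp: cols_def)
  \<comment> \<open>The rank is the size of a maximal independent set of columns. By the exchange
    lemma such a set is no larger than the set \<open>W\<close> whose span contains it.\<close>
  obtain S where S: "maximal S (\<lambda>T. T \<subseteq> set (cols A) \<and> lin_indpt T)" "finite S"
    using maximal_exists_superset[of "set (cols A)" "\<lambda>T. T \<subseteq> set (cols A) \<and> lin_indpt T" "{}"]
      finite_lin_indpt2[of "{}"] by auto
  then have "S \<subseteq> span W" "lin_indpt S" using span by (auto simp: maximal_def)
  then have "card S \<le> card W"
    using replacement[OF S(2) W(2)] W(1) by auto
  also have "card W \<le> card ?I" unfolding W_def by (rule card_image_le) simp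
  finally show ?thesis using rank_card_indpt[OF A S(1)] by simp
qed

section \<open>Block rows and received matrices\<close>

lemma block_column_less:
  fixes j m d k :: nat
  assumes "j < m" "d < k"
  shows "j * k + d < m * k"
proof -
  have "j * k + d < Suc j * k" using assms by simp
  also have "\<dots> \<le> m * k" using assms by (intro mult_le_mono1) simp
  finally show ?thesis .
qed

lemma block_row_carrier: "block_row m k B \<in> carrier_mat k (m * k)"
  by (simp add: block_row_def)

lemma block_row_index:
  assumes "a < k" "j < m" "d < k"
  shows "block_row m k B $$ (a, j * k + d) = B j $$ (a, d)"
  using assms block_column_less[OF assms(2,3)] by (simp add: block_row_def)

lemma block_row_cong:
  assumes "\<And>j. j < m \<Longrightarrow> B j = C j"
  shows "block_row m k B = block_row m k C"
  unfolding block_row_def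
proof (rule cong_mat)
  fix a c assume "c < m * k"
  then have "c div k < m" by (simp add: less_mult_imp_div_less)
  then show "(case (a, c) of (a, c) \<Rightarrow> B (c div k) $$ (a, c mod k)) =
      (case (a, c) of (a, c) \<Rightarrow> C (c div k) $$ (a, c mod k))"
    using assms by simp
qed auto

lemma block_row_eqD:
  assumes eq: "block_row m k B = block_row m k C" and j: "j < m"
    and carrier: "B j \<in> carrier_mat k k" "C j \<in> carrier_mat k k"
  shows "B j = C j"
proof (rule eq_matI)
  fix a d assume "a < dim_row (C j)" "d < dim_col (C j)"
  then have "a < k" "d < k" using carrier by auto
  then show "B j $$ (a, d) = C j $$ (a, d)"
    using block_row_index[of a k j m d B] block_row_index[of a k j m d C] eq j by simp
qed (use carrier in auto)

lemma mult_block_row_index: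
  assumes A: "A \<in> carrier_mat s k" and B: "B j \<in> carrier_mat k k" and "a < s" "j < m" "d < k"
  shows "(A * block_row m k B) $$ (a, j * k + d) = (A * B j) $$ (a, d)"
  unfolding mult_mat_index[OF A block_row_carrier assms(3) block_column_less[OF assms(4,5)]]
    mult_mat_index[OF A B assms(3,5)]
  by (intro sum.cong) (use assms in \<open>auto simp: block_row_index\<close>)

text \<open>The channel wipes a whole column as soon as one of its symbols is erased, so only this
  set of columns matters for decoding. Columns are numbered within block \<open>j\<close>.\<close>

definition erased_columns :: "nat \<Rightarrow> nat \<Rightarrow> 'a option mat \<Rightarrow> nat \<Rightarrow> nat set" where
  "erased_columns s k E j = {d. d < k \<and> (\<exists>b<s. E $$ (b, j * k + d) = None)}"

lemma received_index:
  assumes "A \<in> carrier_mat s k" "U \<in> carrier_mat k n" "E \<in> erasure_patterns s n" "a < s" "c < n"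
  shows "received A U E $$ (a, c) =
    (if \<exists>b<s. E $$ (b, c) = None then None else Some ((A * U) $$ (a, c)))"
proof -
  have E: "E $$ (b, c) = None \<or> E $$ (b, c) = Some 0" if "b < s" for b
    using assms that unfolding erasure_patterns_def elements_mat_def by fastforce
  have add: "symbol_add (Some y) e = None \<longleftrightarrow> e = None" for y :: 'a and e by (cases e) auto
  show ?thesis
    using assms E[of a] by (auto simp: received_def erase_columns_def symbol_mat_add_def add)
qed

lemma received_eqD:
  assumes "received A U E = received A' U' E"
    and "A \<in> carrier_mat s k" "U \<in> carrier_mat k n" "A' \<in> carrier_mat s k" "U' \<in> carrier_mat k n"
    and "E \<in> erasure_patterns s n" "a < s" "c < n" "\<And>b. b < s \<Longrightarrow> E $$ (b, c) \<noteq> None"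
  shows "(A * U) $$ (a, c) = (A' * U') $$ (a, c)"
proof -
  have "\<not> (\<exists>b<s. E $$ (b, c) = None)" using assms(9) by blast
  then have "received A U E $$ (a, c) = Some ((A * U) $$ (a, c))"
    "received A' U' E $$ (a, c) = Some ((A' * U') $$ (a, c))"
    unfolding received_index[OF assms(2,3,6-8)] received_index[OF assms(4-8)] by simp_all
  then show ?thesis using assms(1) by simp
qed

section \<open>Sufficient condition for unique decoding\<close>

context irreducible_companion
begin

lemma one_neq_zero_mat: "1\<^sub>m k \<noteq> (0\<^sub>m k k :: 'a mat)"
proof
  assume "1\<^sub>m k = (0\<^sub>m k k :: 'a mat)"
  then have "(1\<^sub>m k :: 'a mat) $$ (0, 0) = 0\<^sub>m k k $$ (0, 0)" by simp
  then show False using k_pos by simp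
qed

lemma normal_blocks_K:
  assumes "normal_blocks P m i B" "j < m"
  shows "B j \<in> poly_algebra P"
proof (cases i j rule: linorder_cases)
  case less
  then show ?thesis using assms by (simp add: normal_blocks_def)
next
  case equal
  then show ?thesis using assms K_1 by (simp add: normal_blocks_def)
next
  case greater
  then show ?thesis using assms K_0 by (simp add: normal_blocks_def)
qed

text \<open>A nonzero element of the field is invertible, so the rank bound applies with
  \<open>A\<close> of rank \<open>s\<close>. Consequently fewer than \<open>s\<close> lost columns
  cannot hide that \<open>A * C\<close> is nonzero.\<close>

lemma deletion_nonzero_cols:
  assumes "A \<in> deletion_matrices s k" "C \<in> poly_algebra P" "C \<noteq> 0\<^sub>m k k"
  shows "s \<le> card {c. c < k \<and> col (A * C) c \<noteq> 0\<^sub>v s}"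
proof -
  obtain D where D: "D \<in> poly_algebra P" "C * D = 1\<^sub>m k" using K_inverse assms(2,3) .
  have "A \<in> carrier_mat s k" "vec_space.rank s A = s"
    using assms(1) by (auto simp: deletion_matrices_def)
  then show ?thesis
    using vec_space.rank_le_nonzero_cols[of A s k C D] K_carrier[OF assms(2)] K_carrier[OF D(1)] D(2)
    by simp
qed

text \<open>Uniqueness of the normal form. Different pivot positions would force an identity block
  or \<open>D\<close> itself to be zero; at the common pivot the relation reads
  \<open>1 = D * 1\<close>.\<close>

lemma normal_blocks_multiple_eq:
  assumes B: "normal_blocks P m i B" and C: "normal_blocks P m i' C"
    and D: "D \<in> poly_algebra P" "D \<noteq> 0\<^sub>m k k"
    and mult: "\<And>j. j < m \<Longrightarrow> B j = D * C j" and j: "j < m"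
  shows "B j = C j"
proof -
  note Dc = K_carrier[OF D(1)]
  have im: "i < m" "i' < m" using B C by (auto simp: normal_blocks_def)
  have "\<not> i < i'"
  proof
    assume "i < i'"
    then have "C i = 0\<^sub>m k k" using C by (simp add: normal_blocks_def)
    then have "B i = 0\<^sub>m k k" using mult[OF im(1)] Dc by simp
    moreover have "B i = 1\<^sub>m k" using B by (simp add: normal_blocks_def)
    ultimately show False using one_neq_zero_mat by simp
  qed
  moreover have "\<not> i' < i"
  proof
    assume "i' < i"
    then have "B i' = 0\<^sub>m k k" using B by (simp add: normal_blocks_def)
    moreover have "C i' = 1\<^sub>m k" using C by (simp add: normal_blocks_def)
    ultimately show False using mult[OF im(2)] Dc D(2) by simp
  qed
  ultimately have "B i = 1\<^sub>m k" "C i = 1\<^sub>m k" using B C by (auto simp: normal_blocks_def)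
  then have "D = 1\<^sub>m k" using mult[OF im(1)] Dc by simp
  then show ?thesis using mult[OF j] K_carrier[OF normal_blocks_K[OF C j]] by simp
qed

lemma uniquely_decodable_if:
  assumes B: "normal_blocks P m i B" and E: "E \<in> erasure_patterns (k - r) (m * k)"
    and few: "\<And>j. j < m \<Longrightarrow> card (erased_columns (k - r) k E j) < k - r"
    and t: "t < m" "B t \<noteq> 0\<^sub>m k k" "erased_columns (k - r) k E t = {}"
  shows "uniquely_decodable m k P r (block_row m k B) E"
  unfolding uniquely_decodable_def
proof (intro ballI impI)
  let ?s = "k - r"
  fix U' A A'
  assume "U' \<in> spread_matrices m k P" and A: "A \<in> deletion_matrices ?s k"
    and A': "A' \<in> deletion_matrices ?s k" and eq: "received A (block_row m k B) E = received A' U' E"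
  then obtain i' C where U': "U' = block_row m k C" and C: "normal_blocks P m i' C"
    by (auto simp: spread_matrices_def)
  note Ac = A[unfolded deletion_matrices_def, simplified, THEN conjunct1]
  note A'c = A'[unfolded deletion_matrices_def, simplified, THEN conjunct1]
  have BK: "B j \<in> poly_algebra P" and CK: "C j \<in> poly_algebra P" if "j < m" for j
    using that normal_blocks_K B C by auto
  note Bc = K_carrier[OF BK] and Cc = K_carrier[OF CK]
  \<comment> \<open>Outside the lost columns, equality of the received matrices is equality of the
    products block by block.\<close>
  have agree: "(A * B j) $$ (a, d) = (A' * C j) $$ (a, d)"
    if "j < m" "d < k" "d \<notin> erased_columns ?s k E j" "a < ?s" for j d a
  proof -
    have "(A * block_row m k B) $$ (a, j * k + d) = (A' * block_row m k C) $$ (a, j * k + d)"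
      using that(2,3)
      by (intro received_eqD[OF eq[unfolded U'] Ac block_row_carrier A'c block_row_carrier E that(4)]
          block_column_less[OF that(1,2)]) (auto simp: erased_columns_def)
    moreover have "(A * block_row m k B) $$ (a, j * k + d) = (A * B j) $$ (a, d)"
      by (rule mult_block_row_index) (use Ac Bc that in auto)
    moreover have "(A' * block_row m k C) $$ (a, j * k + d) = (A' * C j) $$ (a, d)"
      by (rule mult_block_row_index) (use A'c Cc that in auto)
    ultimately show ?thesis by simp
  qed
  \<comment> \<open>Block \<open>t\<close> has no lost column, so it is compared completely.\<close>
  have t_eq: "A * B t = A' * C t"
    by (rule eq_matI) (use agree[OF t(1)] t(3) Ac A'c Bc[OF t(1)] Cc[OF t(1)] in auto)
  have "C t \<noteq> 0\<^sub>m k k"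
  proof
    assume "C t = 0\<^sub>m k k"
    then have "A * B t = 0\<^sub>m ?s k" using t_eq A'c by simp
    then have "{c. c < k \<and> col (A * B t) c \<noteq> 0\<^sub>v ?s} = {}" by auto
    then have "card {c. c < k \<and> col (A * B t) c \<noteq> 0\<^sub>v ?s} = 0" by (simp only: card.empty)
    then have "?s \<le> 0" using deletion_nonzero_cols[OF A BK[OF t(1)] t(2)] by (simp only:)
    then show False using few[OF t(1)] by simp
  qed
  then obtain X where X: "X \<in> poly_algebra P" "C t * X = 1\<^sub>m k"
    using K_inverse[OF CK[OF t(1)]] by metis
  note Xc = K_carrier[OF X(1)]
  \<comment> \<open>The equation \<open>A * B t = A' * C t\<close> is solved for \<open>A'\<close>
    with the inverse \<open>X\<close> of \<open>C t\<close>, which gives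
    \<open>A' = A * D\<close>.\<close>
  define D where "D = B t * X"
  have D: "D \<in> poly_algebra P" unfolding D_def by (intro K_mult BK t X)
  note Dc = K_carrier[OF D]
  have "A' = A' * (C t * X)" using A'c X by simp
  also have "\<dots> = A' * C t * X" using A'c Cc[OF t(1)] Xc by (simp add: assoc_mult_mat[of _ _ k _ k _ k])
  also have "\<dots> = A * D"
    unfolding t_eq[symmetric] D_def using Ac Bc[OF t(1)] Xc by (simp add: assoc_mult_mat[of _ _ k _ k _ k])
  finally have A'_eq: "A' = A * D" .
  have mult: "B j = D * C j" if j: "j < m" for j
  proof (rule ccontr)
    assume neq: "B j \<noteq> D * C j"
    \<comment> \<open>This difference lies in the field, and \<open>A * ?C\<close> equals
      \<open>A * B j - A' * C j\<close>, whose nonzero columns are all lost ones. If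
      \<open>?C\<close> were nonzero there would be at least \<open>?s\<close> of them.\<close>
    let ?C = "B j - D * C j"
    have DC: "D * C j \<in> poly_algebra P" by (intro K_mult D CK j)
    have "?C \<noteq> 0\<^sub>m k k"
      using neq minus_mat_eq_0_imp_eq[OF Bc[OF j] K_carrier[OF DC]] by blast
    then have "?s \<le> card {c. c < k \<and> col (A * ?C) c \<noteq> 0\<^sub>v ?s}"
      by (intro deletion_nonzero_cols A K_diff BK j DC)
    also have "\<dots> \<le> card (erased_columns ?s k E j)"
    proof (rule card_mono)
      show "finite (erased_columns ?s k E j)" by (simp add: erased_columns_def)
      have "A * ?C = A * B j - A' * C j"
        unfolding A'_eq using mult_minus_distrib_mat[OF Ac Bc[OF j] K_carrier[OF DC]]
          assoc_mult_mat[OF Ac Dc Cc[OF j]] by simp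
      moreover have "col (A * B j - A' * C j) c = 0\<^sub>v ?s"
        if "c < k" "c \<notin> erased_columns ?s k E j" for c
        by (rule eq_vecI) (use agree[OF j that] that Ac A'c Bc[OF j] Cc[OF j] in auto)
      ultimately show "{c. c < k \<and> col (A * ?C) c \<noteq> 0\<^sub>v ?s} \<subseteq> erased_columns ?s k E j"
        by auto
    qed
    finally show False using few[OF j] by simp
  qed
  have "D \<noteq> 0\<^sub>m k k" using mult[OF t(1)] t(2) Cc[OF t(1)] by auto
  then have "block_row m k B = U'"
    unfolding U' using normal_blocks_multiple_eq[OF B C D _ mult] by (intro block_row_cong) blast
  then show "rowsp (block_row m k B) = rowsp U'" by simp
qed

end

section \<open>Counting erasure patterns\<close>

text \<open>A pattern on one block is encoded by the set of erased rows in each of the \<open>k\<close> columns.\<close>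

definition block_patterns :: "nat \<Rightarrow> nat \<Rightarrow> (nat \<Rightarrow> nat set) set" where
  "block_patterns s k = ({..<k} \<rightarrow>\<^sub>E Pow {..<s})"

definition light_patterns :: "nat \<Rightarrow> nat \<Rightarrow> (nat \<Rightarrow> nat set) set" where
  "light_patterns s k = {f \<in> block_patterns s k. card {d. d < k \<and> f d \<noteq> {}} < s}"

definition pattern_matrix :: "nat \<Rightarrow> nat \<Rightarrow> nat \<Rightarrow> (nat \<Rightarrow> nat \<Rightarrow> nat set) \<Rightarrow> 'a :: zero option mat" where
  "pattern_matrix s k m g =
     mat s (m * k) (\<lambda>(a, c). if a \<in> g (c div k) (c mod k) then None else Some 0)"

lemma finite_block_patterns: "finite (block_patterns s k)"
  by (simp add: block_patterns_def finite_PiE)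

lemma finite_light_patterns: "finite (light_patterns s k)"
  by (simp add: light_patterns_def finite_block_patterns)

text \<open>Sort the patterns by the set \<open>D\<close> of columns that carry an erasure. Each
  column in \<open>D\<close> has \<open>2 ^ s - 1\<close> nonempty sets of erased rows, every other
  column has one choice, and \<open>D\<close> runs over the subsets with fewer than \<open>s\<close>
  elements.\<close>

lemma card_light_patterns:
  "card (light_patterns s k) = (\<Sum>j<s. (k choose j) * (2 ^ s - 1) ^ j)"
proof -
  define F where "F D = (\<Pi>\<^sub>E d\<in>{..<k}. if d \<in> D then Pow {..<s} - {{}} else {{}})" for D
  define \<D> where "\<D> = {D. D \<subseteq> {..<k} \<and> card D < s}"
  have "finite \<D>" by (rule finite_subset[of _ "Pow {..<k}"]) (auto simp: \<D>_def)
  \<comment> \<open>A pattern determines its support, so the families \<open>F D\<close> are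
    pairwise disjoint.\<close>
  have F_support: "D = {d. d < k \<and> f d \<noteq> {}}" if f: "f \<in> F D" and D: "D \<subseteq> {..<k}" for f D
  proof -
    have "f d \<noteq> {} \<longleftrightarrow> d \<in> D" if "d < k" for d
      using PiE_mem[OF f[unfolded F_def], of d] that by (auto split: if_splits)
    then show ?thesis using D by auto
  qed
  have "light_patterns s k = (\<Union>D\<in>\<D>. F D)"
  proof (intro equalityI subsetI)
    fix f assume f: "f \<in> light_patterns s k"
    let ?D = "{d. d < k \<and> f d \<noteq> {}}"
    have "?D \<in> \<D>" "f \<in> F ?D"
      using f by (auto simp: light_patterns_def block_patterns_def \<D>_def F_def PiE_iff)
    then show "f \<in> (\<Union>D\<in>\<D>. F D)" by blast
  next
    fix f assume "f \<in> (\<Union>D\<in>\<D>. F D)"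
    then obtain D where D: "D \<in> \<D>" "f \<in> F D" by blast
    then have "D = {d. d < k \<and> f d \<noteq> {}}" by (intro F_support) (auto simp: \<D>_def)
    moreover have "f \<in> block_patterns s k"
      using D(2) by (auto simp: F_def block_patterns_def PiE_iff split: if_splits)
    ultimately show "f \<in> light_patterns s k"
      using D(1) by (auto simp: light_patterns_def \<D>_def)
  qed
  then have "card (light_patterns s k) = card (\<Union>D\<in>\<D>. F D)" by simp
  also have "\<dots> = (\<Sum>D\<in>\<D>. card (F D))"
  proof (rule card_UN_disjoint)
    show "\<forall>D\<in>\<D>. finite (F D)" by (auto simp: F_def intro!: finite_PiE)
    show "\<forall>D\<in>\<D>. \<forall>D'\<in>\<D>. D \<noteq> D' \<longrightarrow> F D \<inter> F D' = {}"
    proof (intro ballI impI)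
      fix D D' assume *: "D \<in> \<D>" "D' \<in> \<D>" "D \<noteq> D'"
      have "D = D'" if "f \<in> F D" "f \<in> F D'" for f
        using F_support[OF that(1)] F_support[OF that(2)] *(1,2) by (simp add: \<D>_def)
      then show "F D \<inter> F D' = {}" using *(3) by blast
    qed
  qed fact
  also have "\<dots> = (\<Sum>D\<in>\<D>. (2 ^ s - 1) ^ card D)"
  proof (rule sum.cong[OF refl])
    fix D assume "D \<in> \<D>"
    then have D: "D \<subseteq> {..<k}" by (simp add: \<D>_def)
    have "card (F D) = (\<Prod>d<k. if d \<in> D then 2 ^ s - 1 else 1)"
      unfolding F_def by (simp add: card_PiE if_distrib card_Pow card_Diff_singleton cong: if_cong)
    also have "\<dots> = (\<Prod>d\<in>D. 2 ^ s - 1)"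
      using D by (simp add: prod.If_cases Int_absorb1)
    finally show "card (F D) = (2 ^ s - 1) ^ card D" by simp
  qed
  also have "\<dots> = (\<Sum>j<s. \<Sum>D\<in>{D \<in> \<D>. card D = j}. (2 ^ s - 1) ^ card D)"
    by (rule sum.group[symmetric]) (use \<open>finite \<D>\<close> in \<open>auto simp: \<D>_def\<close>)
  also have "\<dots> = (\<Sum>j<s. (k choose j) * (2 ^ s - 1) ^ j)"
  proof (rule sum.cong[OF refl])
    fix j assume "j \<in> {..<s}"
    then have "{D \<in> \<D>. card D = j} = {D. D \<subseteq> {..<k} \<and> card D = j}" by (auto simp: \<D>_def)
    then show "(\<Sum>D\<in>{D \<in> \<D>. card D = j}. (2 ^ s - 1) ^ card D) = (k choose j) * (2 ^ s - 1) ^ j"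
      by (simp add: n_subsets)
  qed
  finally show ?thesis .
qed

lemma N_patterns_eq_card:
  assumes "r < k"
  shows "N_patterns k r = real (card (light_patterns (k - r) k))"
proof -
  \<comment> \<open>Here \<open>r < k\<close> matters: for \<open>k - r = 0\<close> the truncated
    subtraction would leave the index 0 on the left and nothing on the right.\<close>
  have "{0..k - r - 1} = {..<k - r}" using assms by auto
  then show ?thesis
    by (simp add: N_patterns_def card_light_patterns of_nat_diff)
qed

lemma pattern_matrix_in_erasure_patterns: "pattern_matrix s k m g \<in> erasure_patterns s (m * k)"
  by (auto simp: erasure_patterns_def pattern_matrix_def elements_mat_def split: if_splits)

lemma pattern_matrix_index:
  assumes "a < s" "j < m" "d < k"
  shows "pattern_matrix s k m g $$ (a, j * k + d) = (if a \<in> g j d then None else Some 0)"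
  using assms block_column_less[OF assms(2,3)] by (simp add: pattern_matrix_def)

lemma erased_columns_pattern_matrix:
  assumes "g j \<in> block_patterns s k" "j < m"
  shows "erased_columns s k (pattern_matrix s k m g) j = {d. d < k \<and> g j d \<noteq> {}}"
proof -
  have "(\<exists>b<s. pattern_matrix s k m g $$ (b, j * k + d) = None) \<longleftrightarrow> g j d \<noteq> {}" if d: "d < k" for d
  proof -
    have "g j d \<subseteq> {..<s}" using assms(1) d by (auto simp: block_patterns_def)
    moreover have "(\<exists>b<s. pattern_matrix s k m g $$ (b, j * k + d) = None) \<longleftrightarrow> (\<exists>b<s. b \<in> g j d)"
      by (auto simp: pattern_matrix_index[OF _ assms(2) d] split: if_splits)
    ultimately show ?thesis by blast
  qed
  then show ?thesis unfolding erased_columns_def by blast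
qed

lemma inj_on_pattern_matrix:
  "inj_on (pattern_matrix s k m :: _ \<Rightarrow> 'a :: zero option mat) ({..<m} \<rightarrow>\<^sub>E block_patterns s k)"
proof (rule inj_onI)
  fix g h assume g: "g \<in> {..<m} \<rightarrow>\<^sub>E block_patterns s k" and h: "h \<in> {..<m} \<rightarrow>\<^sub>E block_patterns s k"
    and eq: "(pattern_matrix s k m g :: 'a option mat) = pattern_matrix s k m h"
  show "g = h"
  proof (rule PiE_ext[OF g h])
    fix j assume "j \<in> {..<m}"
    then have j: "j < m" by simp
    have gj: "g j \<in> block_patterns s k" and hj: "h j \<in> block_patterns s k"
      using g h j by (auto simp: PiE_iff)
    show "g j = h j"
    proof (rule PiE_ext[OF gj[unfolded block_patterns_def] hj[unfolded block_patterns_def]])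
      fix d assume "d \<in> {..<k}"
      then have d: "d < k" by simp
      have "g j d \<subseteq> {..<s}" "h j d \<subseteq> {..<s}"
        using gj hj d by (auto simp: block_patterns_def)
      moreover have "b \<in> g j d \<longleftrightarrow> b \<in> h j d" if b: "b < s" for b
        using arg_cong[OF eq, of "\<lambda>M. M $$ (b, j * k + d)"]
        by (simp add: pattern_matrix_index[OF b j d] split: if_splits)
      ultimately show "g j d = h j d" by blast
    qed
  qed
qed

text \<open>Count the complement: avoiding \<open>z\<close> at every place of \<open>T\<close>
  leaves one choice fewer at each of these places. In the application \<open>G\<close> consists of
  the light patterns of a block and \<open>z\<close> is the pattern without erasures.\<close>

lemma card_PiE_meeting:
  assumes T: "T \<subseteq> {..<m}" and G: "finite G" "z \<in> G"
  shows "real (card {g \<in> {..<m} \<rightarrow>\<^sub>E G. \<exists>t\<in>T. g t = z}) =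
    real (card G) ^ m * (1 - ((real (card G) - 1) / real (card G)) ^ card T)"
proof -
  let ?A = "{..<m} \<rightarrow>\<^sub>E G" and ?B = "\<Pi>\<^sub>E j\<in>{..<m}. if j \<in> T then G - {z} else G"
  let ?N = "real (card G)"
  have pos: "0 < card G" using G by (auto simp: card_gt_0_iff)
  have "{g \<in> ?A. \<exists>t\<in>T. g t = z} = ?A - ?B"
    using T unfolding PiE_def Pi_def by (auto split: if_splits)
  moreover have "?B \<subseteq> ?A" by (rule PiE_mono) auto
  moreover have "finite ?A" using G by (simp add: finite_PiE)
  ultimately have "card {g \<in> ?A. \<exists>t\<in>T. g t = z} = card ?A - card ?B" "card ?B \<le> card ?A"
    by (auto intro: card_Diff_subset card_mono finite_subset)
  then have "real (card {g \<in> ?A. \<exists>t\<in>T. g t = z}) = real (card ?A) - real (card ?B)" by simp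
  also have "real (card ?A) = ?N ^ m" by (simp add: card_PiE)
  also have "real (card ?B) = (\<Prod>j<m. if j \<in> T then ?N - 1 else ?N)"
    using G pos by (simp add: card_PiE if_distrib card_Diff_singleton of_nat_diff cong: if_cong)
  also have "\<dots> = (\<Prod>j<m. ?N * (if j \<in> T then (?N - 1) / ?N else 1))"
    using pos by (intro prod.cong) auto
  also have "\<dots> = ?N ^ m * ((?N - 1) / ?N) ^ card T"
    using T by (simp only: prod.distrib) (simp add: prod.If_cases Int_absorb1)
  finally show ?thesis by (simp add: right_diff_distrib)
qed

text \<open>Infinite sets have cardinality 0, so finiteness is required before an injection can
  bound the number of correctable patterns from below.\<close>

lemma finite_erasure_patterns: "finite (erasure_patterns s n :: 'a :: zero option mat set)"
proof (rule finite_subset)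
  let ?F = "\<lambda>f. mat s n f :: 'a option mat"
  show "(erasure_patterns s n :: 'a option mat set)
      \<subseteq> ?F ` (({..<s} \<times> {..<n}) \<rightarrow>\<^sub>E {Some 0, None})"
  proof
    fix E :: "'a option mat" assume E: "E \<in> erasure_patterns s n"
    let ?f = "\<lambda>x\<in>{..<s} \<times> {..<n}. E $$ x"
    have "E = ?F ?f" using E by (intro eq_matI) (auto simp: erasure_patterns_def)
    moreover have "E $$ (a, c) \<in> {Some 0, None}" if "a < s" "c < n" for a c
    proof -
      have "E $$ (a, c) \<in> elements_mat E"
        by (rule elements_matI[of _ s n]) (use E that in \<open>auto simp: erasure_patterns_def\<close>)
      then show ?thesis using E by (auto simp: erasure_patterns_def)
    qed
    then have "?f \<in> ({..<s} \<times> {..<n}) \<rightarrow>\<^sub>E {Some 0, None}"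
      by (intro restrict_PiE_iff[THEN iffD2]) auto
    ultimately show "E \<in> ?F ` (({..<s} \<times> {..<n}) \<rightarrow>\<^sub>E {Some 0, None})" by blast
  qed
qed (simp add: finite_PiE)

section \<open>The average over all codewords\<close>

text \<open>The Hamming weight enumerator of all words over \<open>K\<close> with coordinates in
  \<open>I\<close>. The weight is a product over the coordinates, so sum and product can be
  exchanged; one coordinate contributes 1 for \<open>z\<close> and \<open>x\<close> for each other
  value.\<close>

lemma sum_power_nonzero_coordinates:
  fixes x :: real
  assumes "finite I" "finite K" "z \<in> K"
  shows "(\<Sum>f\<in>I \<rightarrow>\<^sub>E K. x ^ card {t \<in> I. f t \<noteq> z}) = (1 + (real (card K) - 1) * x) ^ card I"
proof -
  have "(\<Sum>f\<in>I \<rightarrow>\<^sub>E K. x ^ card {t \<in> I. f t \<noteq> z}) =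
      (\<Sum>f\<in>I \<rightarrow>\<^sub>E K. \<Prod>t\<in>I. if f t \<noteq> z then x else 1)"
    using assms(1) by (simp add: prod.If_cases Int_def)
  also have "\<dots> = (\<Prod>t\<in>I. \<Sum>y\<in>K. if y \<noteq> z then x else 1)"
    using assms by (intro prod_sum_PiE[symmetric])
  also have "(\<Sum>y\<in>K. if y \<noteq> z then x else 1) = 1 + (real (card K) - 1) * x"
  proof -
    have "(\<Sum>y\<in>K. if y \<noteq> z then x else 1) = 1 + (\<Sum>y\<in>K - {z}. if y \<noteq> z then x else 1)"
      using assms by (subst sum.remove[of _ z]) auto
    also have "(\<Sum>y\<in>K - {z}. if y \<noteq> z then x else 1) = (\<Sum>y\<in>K - {z}. x)"
      by (intro sum.cong) auto
    also have "\<dots> = (real (card K) - 1) * x"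
      using assms card_gt_0_iff[of K] by (auto simp: card_Diff_singleton of_nat_diff)
    finally show ?thesis .
  qed
  finally show ?thesis by simp
qed

context irreducible_companion
begin

section \<open>The bound for a single codeword\<close>

lemma card_correctable_ge:
  assumes r: "r < k" and B: "normal_blocks P m i B"
  shows "N_patterns k r ^ m * (1 - ((N_patterns k r - 1) / N_patterns k r) ^
      (card {t. i < t \<and> t < m \<and> B t \<noteq> 0\<^sub>m k k} + 1))
    \<le> real (card (correctable_patterns m k P r (block_row m k B)))"
proof -
  let ?s = "k - r" and ?l = "card {t. i < t \<and> t < m \<and> B t \<noteq> 0\<^sub>m k k}"
  define T where "T = {t. t < m \<and> B t \<noteq> 0\<^sub>m k k}"
  \<comment> \<open>The erasure-free block pattern, made extensional in order to lie in the function
    space. It is light because \<open>0 < k - r\<close>.\<close>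
  define z :: "nat \<Rightarrow> nat set" where "z = (\<lambda>d\<in>{..<k}. {})"
  define G where "G = light_patterns ?s k"
  define S where "S = {g \<in> {..<m} \<rightarrow>\<^sub>E G. \<exists>t\<in>T. g t = z}"
  have G: "finite G" "z \<in> G" "G \<subseteq> block_patterns ?s k"
    using r finite_light_patterns by (auto simp: G_def light_patterns_def block_patterns_def z_def cong: conj_cong)
  have T: "T \<subseteq> {..<m}" by (auto simp: T_def)
  have "i < m" "B i = 1\<^sub>m k" "\<And>j. j < i \<Longrightarrow> B j = 0\<^sub>m k k"
    using B by (auto simp: normal_blocks_def)
  \<comment> \<open>The pivot block is the identity and hence nonzero too; it accounts for the
    exponent \<open>l + 1\<close>.\<close>
  then have "T = insert i {t. i < t \<and> t < m \<and> B t \<noteq> 0\<^sub>m k k}"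
    using one_neq_zero_mat by (auto simp: T_def)
  then have card_T: "card T = ?l + 1" by simp
  have "card S \<le> card (correctable_patterns m k P r (block_row m k B))"
  proof (rule card_inj_on_le)
    show "inj_on (pattern_matrix ?s k m) S"
      by (rule inj_on_subset[OF inj_on_pattern_matrix]) (use G(3) PiE_mono[of "{..<m}" "\<lambda>_. G"] in \<open>auto simp: S_def\<close>)
    show "finite (correctable_patterns m k P r (block_row m k B))"
      by (simp add: correctable_patterns_def finite_erasure_patterns)
    show "pattern_matrix ?s k m ` S \<subseteq> correctable_patterns m k P r (block_row m k B)"
    proof (rule image_subsetI)
      fix g assume g: "g \<in> S"
      then obtain t where t: "t < m" "B t \<noteq> 0\<^sub>m k k" "g t = z" by (auto simp: S_def T_def)
      have gj: "g j \<in> light_patterns ?s k" if "j < m" for j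
        using g that by (auto simp: S_def G_def PiE_iff)
      have erased: "erased_columns ?s k (pattern_matrix ?s k m g :: 'a option mat) j = {d. d < k \<and> g j d \<noteq> {}}"
        if "j < m" for j
        by (rule erased_columns_pattern_matrix) (use gj that in \<open>auto simp: light_patterns_def\<close>)
      have "uniquely_decodable m k P r (block_row m k B) (pattern_matrix ?s k m g)"
      proof (rule uniquely_decodable_if[OF B pattern_matrix_in_erasure_patterns])
        show "card (erased_columns ?s k (pattern_matrix ?s k m g :: 'a option mat) j) < ?s" if "j < m" for j
          unfolding erased[OF that] using gj[OF that] by (simp add: light_patterns_def)
        show "erased_columns ?s k (pattern_matrix ?s k m g :: 'a option mat) t = {}"
          unfolding erased[OF t(1)] by (simp add: t(3) z_def)
      qed (fact t)+
      then show "pattern_matrix ?s k m g \<in> correctable_patterns m k P r (block_row m k B)"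
        by (simp add: correctable_patterns_def pattern_matrix_in_erasure_patterns)
    qed
  qed
  then have "real (card S) \<le> real (card (correctable_patterns m k P r (block_row m k B)))" by simp
  moreover have "real (card S) = N_patterns k r ^ m * (1 - ((N_patterns k r - 1) / N_patterns k r) ^ (?l + 1))"
    using card_PiE_meeting[OF T G(1,2)] by (simp only: S_def card_T N_patterns_eq_card[OF r] G_def)
  ultimately show ?thesis by simp
qed

section \<open>Parametrisation of the codewords by pivot and free blocks\<close>

definition normal_tuple :: "nat \<times> (nat \<Rightarrow> 'a mat) \<Rightarrow> nat \<Rightarrow> 'a mat" where
  "normal_tuple = (\<lambda>(i, f) j. if j < i then 0\<^sub>m k k else if j = i then 1\<^sub>m k else f j)"

text \<open>In \<open>normal_blocks\<close> the values of \<open>B\<close> from index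
  \<open>m\<close> on are arbitrary, so many functions \<open>B\<close> give the same matrix.
  Extensional functions on the positions after the pivot remove this ambiguity.\<close>

definition normal_tuples :: "nat \<Rightarrow> (nat \<times> (nat \<Rightarrow> 'a mat)) set" where
  "normal_tuples m = (SIGMA i:{..<m}. {i<..<m} \<rightarrow>\<^sub>E poly_algebra P)"

lemma normal_blocks_normal_tuple:
  assumes "(i, f) \<in> normal_tuples m"
  shows "normal_blocks P m i (normal_tuple (i, f))"
  using assms by (auto simp: normal_blocks_def normal_tuple_def normal_tuples_def PiE_iff)

lemma bij_betw_spread_matrices:
  "bij_betw (\<lambda>x. block_row m k (normal_tuple x)) (normal_tuples m) (spread_matrices m k P)"
proof (rule bij_betw_imageI)
  show "inj_on (\<lambda>x. block_row m k (normal_tuple x)) (normal_tuples m)"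
  proof (rule inj_onI, clarify)
    fix i f i' f' assume x: "(i, f) \<in> normal_tuples m" and y: "(i', f') \<in> normal_tuples m"
      and eq: "block_row m k (normal_tuple (i, f)) = block_row m k (normal_tuple (i', f'))"
    have blocks: "normal_tuple (i, f) j = normal_tuple (i', f') j" if "j < m" for j
      using block_row_eqD[OF eq that] normal_blocks_normal_tuple[OF x] normal_blocks_normal_tuple[OF y]
        normal_blocks_K[OF _ that] K_carrier by blast
    have "i < m" "i' < m" using x y by (auto simp: normal_tuples_def)
    \<comment> \<open>At the smaller of two different pivots one matrix has the identity and the
      other a zero block.\<close>
    have "i = i'"
      using blocks[OF \<open>i < m\<close>] blocks[OF \<open>i' < m\<close>] one_neq_zero_mat
      by (cases i i' rule: linorder_cases) (auto simp: normal_tuple_def)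
    have "f = f'"
    proof (rule PiE_ext)
      show "f \<in> {i<..<m} \<rightarrow>\<^sub>E poly_algebra P" "f' \<in> {i<..<m} \<rightarrow>\<^sub>E poly_algebra P"
        using x y \<open>i = i'\<close> by (auto simp: normal_tuples_def)
      show "f t = f' t" if "t \<in> {i<..<m}" for t
        using blocks[of t] that \<open>i = i'\<close> by (auto simp: normal_tuple_def)
    qed
    with \<open>i = i'\<close> show "i = i' \<and> f = f'" by simp
  qed
  show "(\<lambda>x. block_row m k (normal_tuple x)) ` normal_tuples m = spread_matrices m k P"
  proof (intro equalityI subsetI)
    fix U assume "U \<in> (\<lambda>x. block_row m k (normal_tuple x)) ` normal_tuples m"
    then show "U \<in> spread_matrices m k P"
      using normal_blocks_normal_tuple unfolding spread_matrices_def by fast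
  next
    fix U assume "U \<in> spread_matrices m k P"
    then obtain i B where U: "U = block_row m k B" and B: "normal_blocks P m i B"
      by (auto simp: spread_matrices_def)
    let ?x = "(i, \<lambda>t\<in>{i<..<m}. B t)"
    have "?x \<in> normal_tuples m" using B by (auto simp: normal_tuples_def normal_blocks_def)
    moreover have "U = block_row m k (normal_tuple ?x)"
      unfolding U by (rule block_row_cong) (use B in \<open>auto simp: normal_tuple_def normal_blocks_def\<close>)
    ultimately show "U \<in> (\<lambda>x. block_row m k (normal_tuple x)) ` normal_tuples m" by blast
  qed
qed

text \<open>A pivot at \<open>i\<close> leaves \<open>m - Suc i\<close> free blocks, whose weight
  enumerator is a power of one fixed base. Reversing the order of the pivots gives a geometric
  sum.\<close>

lemma sum_normal_tuples_power:
  fixes x :: real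
  shows "(\<Sum>(i, f)\<in>normal_tuples m. x ^ card {t. i < t \<and> t < m \<and> f t \<noteq> 0\<^sub>m k k}) =
    (\<Sum>i<m. (1 + (real CARD('a) ^ k - 1) * x) ^ i)"
proof -
  have "(\<Sum>(i, f)\<in>normal_tuples m. x ^ card {t. i < t \<and> t < m \<and> f t \<noteq> 0\<^sub>m k k}) =
      (\<Sum>i<m. \<Sum>f\<in>{i<..<m} \<rightarrow>\<^sub>E poly_algebra P. x ^ card {t \<in> {i<..<m}. f t \<noteq> 0\<^sub>m k k})"
    unfolding normal_tuples_def by (subst sum.Sigma) (auto simp: K_finite finite_PiE)
  also have "\<dots> = (\<Sum>i<m. (1 + (real CARD('a) ^ k - 1) * x) ^ (m - Suc i))"
    by (simp only: sum_power_nonzero_coordinates[OF _ K_finite K_0] finite_greaterThanLessThan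
        card_greaterThanLessThan K_card of_nat_power)
  also have "\<dots> = (\<Sum>i<m. (1 + (real CARD('a) ^ k - 1) * x) ^ i)"
    by (rule sum.nat_diff_reindex)
  finally show ?thesis .
qed

lemma card_spread_matrices:
  "real (card (spread_matrices m k P)) = (\<Sum>i<m. (real CARD('a) ^ k) ^ i)"
proof -
  have "real (card (spread_matrices m k P)) = real (card (normal_tuples m))"
    using bij_betw_same_card[OF bij_betw_spread_matrices] by simp
  \<comment> \<open>With the weight \<open>x = 1\<close> the enumerator counts the tuples.\<close>
  also have "\<dots> = (\<Sum>(i, f)\<in>normal_tuples m. 1 ^ card {t. i < t \<and> t < m \<and> f t \<noteq> 0\<^sub>m k k})"
    by (simp add: case_prod_unfold)
  also have "\<dots> = (\<Sum>i<m. (real CARD('a) ^ k) ^ i)"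
    unfolding sum_normal_tuples_power by simp
  finally show ?thesis .
qed

text \<open>Here \<open>x\<close> is the fraction of light block patterns that contain an erasure,
  and the bound for a single codeword is \<open>N_patterns k r ^ m * (1 - x * x ^ l)\<close>.
  Summation produces the weight enumerator once at 1 and once at \<open>x\<close>.\<close>

lemma sum_correctable_ge:
  fixes m r :: nat
  defines "x \<equiv> (N_patterns k r - 1) / N_patterns k r"
  assumes r: "r < k"
  shows "N_patterns k r ^ m * ((\<Sum>i<m. (real CARD('a) ^ k) ^ i)
      - x * (\<Sum>i<m. (1 + (real CARD('a) ^ k - 1) * x) ^ i))
    \<le> (\<Sum>U\<in>spread_matrices m k P. real (card (correctable_patterns m k P r U)))"
proof -
  let ?l = "\<lambda>i f. card {t. i < t \<and> t < m \<and> f t \<noteq> 0\<^sub>m k k}"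
  have "N_patterns k r ^ m * ((\<Sum>i<m. (real CARD('a) ^ k) ^ i)
      - x * (\<Sum>i<m. (1 + (real CARD('a) ^ k - 1) * x) ^ i)) =
      N_patterns k r ^ m * ((\<Sum>(i, f)\<in>normal_tuples m. 1 ^ ?l i f) - x * (\<Sum>(i, f)\<in>normal_tuples m. x ^ ?l i f))"
    unfolding sum_normal_tuples_power by simp
  also have "\<dots> = (\<Sum>(i, f)\<in>normal_tuples m. N_patterns k r ^ m * (1 - x ^ (?l i f + 1)))"
    by (simp add: sum_distrib_left case_prod_unfold sum_subtractf right_diff_distrib)
  also have "\<dots> \<le> (\<Sum>y\<in>normal_tuples m.
      real (card (correctable_patterns m k P r (block_row m k (normal_tuple y)))))"
  proof (rule sum_mono, clarify)
    fix i f assume "(i, f) \<in> normal_tuples m"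
    note B = normal_blocks_normal_tuple[OF this]
    have "{t. i < t \<and> t < m \<and> normal_tuple (i, f) t \<noteq> 0\<^sub>m k k} = {t. i < t \<and> t < m \<and> f t \<noteq> 0\<^sub>m k k}"
      by (auto simp: normal_tuple_def)
    then show "N_patterns k r ^ m * (1 - x ^ (?l i f + 1))
        \<le> real (card (correctable_patterns m k P r (block_row m k (normal_tuple (i, f)))))"
      using card_correctable_ge[OF r B] by (simp add: x_def)
  qed
  also have "\<dots> = (\<Sum>U\<in>spread_matrices m k P. real (card (correctable_patterns m k P r U)))"
    by (rule sum.reindex_bij_betw[OF bij_betw_spread_matrices])
  finally show ?thesis .
qed

lemma average_correctable_ge:
  assumes r: "r < k" and m: "m \<ge> 1"
  shows "N_patterns k r ^ m / (real CARD('a) ^ (m * k) - 1) * (real CARD('a) ^ (m * k)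
      - ((real CARD('a) ^ k - 1) * (N_patterns k r - 1) / N_patterns k r + 1) ^ m)
    \<le> average_correctable m k P r"
proof -
  let ?N = "N_patterns k r" and ?Q = "real CARD('a) ^ k"
  define x where "x = (?N - 1) / ?N"
  define y where "y = 1 + (?Q - 1) * x"
  \<comment> \<open>\<open>S\<close> is the number of codewords, the denominator of the
    average.\<close>
  define S where "S = (\<Sum>i<m. ?Q ^ i)"
  define R where "R = (\<Sum>i<m. y ^ i)"
  have "1 < ?Q" using card_field_ge_2 k_pos by (intro one_less_power) auto
  have "0 < S" unfolding S_def by (rule sum_pos) (use \<open>1 < ?Q\<close> m in \<open>auto simp: lessThan_empty_iff\<close>)
  have Q: "?Q ^ m - 1 = (?Q - 1) * S" unfolding S_def by (rule power_diff_1_eq)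
  \<comment> \<open>The geometric sum is kept in product form because \<open>y = 1\<close> when
    \<open>r = k - 1\<close>, where \<open>?N = 1\<close> and \<open>x = 0\<close>. Since
    \<open>y - 1 = (?Q - 1) * x\<close>, the factor \<open>?Q - 1\<close> is common to both sums and
    cancels.\<close>
  have "y ^ m - 1 = (y - 1) * R" unfolding R_def by (rule power_diff_1_eq)
  then have "?Q ^ m - y ^ m = (?Q - 1) * (S - x * R)"
    using Q by (simp add: y_def algebra_simps)
  moreover have "real CARD('a) ^ (m * k) = ?Q ^ m" by (metis mult.commute power_mult)
  moreover have "(?Q - 1) * (?N - 1) / ?N + 1 = y" by (simp add: y_def x_def)
  ultimately have "?N ^ m / (real CARD('a) ^ (m * k) - 1) * (real CARD('a) ^ (m * k)
      - ((?Q - 1) * (?N - 1) / ?N + 1) ^ m) = ?N ^ m / ((?Q - 1) * S) * ((?Q - 1) * (S - x * R))"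
    using Q by simp
  also have "\<dots> = ?N ^ m * (S - x * R) / S" using \<open>1 < ?Q\<close> by simp
  also have "\<dots> \<le> average_correctable m k P r"
    unfolding average_correctable_def card_spread_matrices S_def[symmetric]
    by (rule divide_right_mono)
      (use sum_correctable_ge[OF r, of m] \<open>0 < S\<close> in \<open>simp_all add: S_def R_def y_def x_def\<close>)
  finally show ?thesis .
qed

end

theorem corollary7p2:
  fixes p :: "'a :: {field, finite} poly"
    and P :: "'a mat"
    and q k m n r :: nat
  assumes "q = CARD('a)"
    and "lead_coeff p = 1" and "irreducible p" and "degree p = k"
    and "P = companion_matrix p"
    and "m \<ge> 1" and "n = m * k"
    and "r < k"
  shows "(\<forall>i B l. normal_blocks P m i B \<and> l = card {t. i < t \<and> t < m \<and> B t \<noteq> 0\<^sub>m k k} \<longrightarrow>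
            real (card (correctable_patterns m k P r (block_row m k B)))
              \<ge> N_patterns k r ^ m * (1 - ((N_patterns k r - 1) / N_patterns k r) ^ (l + 1))) \<and>
         average_correctable m k P r
           \<ge> N_patterns k r ^ m / (real q ^ n - 1)
               * (real q ^ n - ((real q ^ k - 1) * (N_patterns k r - 1) / N_patterns k r + 1) ^ m)"
proof -
  interpret irreducible_companion p P k
    by unfold_locales (fact assms)+
  show ?thesis
    using card_correctable_ge[OF \<open>r < k\<close>] average_correctable_ge[OF \<open>r < k\<close> \<open>m \<ge> 1\<close>]
    by (auto simp: \<open>q = CARD('a)\<close> \<open>n = m * k\<close>)
qed

end
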